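(* Suppose that $\Psi(\Theta)$ is finite with $\nu_\Psi$ equal to counting measure and that $\pi_\Psi(\psi)>0$ for every $\psi\in\Psi(\Theta)$. Then for $\gamma\in[0,1]$ the $\gamma$-relative belief credible region $C_{\Psi,\gamma}(x)$ is a $\gamma$-lowest posterior loss credible region for the loss function $$L_{RB}(\theta,\psi)=\frac{I_{\{\psi\}^c}(\Psi(\theta))}{\pi_\Psi(\Psi(\theta))},$$ i.e. $C_{\Psi,\gamma}(x)=D_\gamma(x)$.
   Context: Setting. $\{f(\cdot\,|\,\theta):\theta\in\Theta\}$ is a family of probability densities on a sample space $\mathcal X$; $\Theta$ carries a proper prior $\Pi$ with density $\pi$. The prior predictive density is $m(x)=\int_\Theta f(x\,|\,\theta)\,\Pi(d\theta)$, and the posterior has density $\pi(\theta\,|\,x)=\pi(\theta)f(x\,|\,\theta)/m(x)$, for $x$ with $0<m(x)<\infty$. $\Psi:\Theta\to\Psi(\Theta)$ is a (measurable) parameter of interest, with marginal prior $\Pi_\Psi$ and marginal posterior $\Pi_\Psi(\cdot\,|\,x)$ on $\Psi(\Theta)$, having densities $\pi_\Psi$ and $\pi_\Psi(\cdot\,|\,x)$ with respect to $\nu_\Psi$. The relative belief ratio is $RB_\Psi(\psi\,|\,x)=\pi_\Psi(\psi\,|\,x)/\pi_\Psi(\psi)$. $I_A$ is the indicator function of $A$. Relative belief region: $C_{\Psi,\gamma}(x)=\{\psi:RB_\Psi(\psi\,|\,x)\ge c_\gamma(x)\}$, where $c_\gamma(x)=\sup\{c:\Pi_\Psi(\{\psi:RB_\Psi(\psi\,|\,x)\ge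 c\}\,|\,x)\ge\gamma\}$. Lowest posterior loss region: for a loss $L(\theta,\psi)$ depending on $\theta$ only through $\Psi(\theta)$, so that it may be viewed as a function on $\Psi(\Theta)\times\Psi(\Theta)$, let $r(\psi\,|\,x)=\int_{\Psi(\Theta)}L(\zeta,\psi)\,\Pi_\Psi(d\zeta\,|\,x)$ be the posterior risk of the constant decision $\psi$. The $\gamma$-lowest posterior loss credible region is $D_\gamma(x)=\{\psi:r(\psi\,|\,x)\le d_\gamma(x)\}$, where $d_\gamma(x)=\inf\{k:\Pi_\Psi(\{\psi:r(\psi\,|\,x)\le k\}\,|\,x)\ge\gamma\}$. Here $c$ and $k$ range over the extended real line (relevant only when $\gamma=0$). *)

theory Defs
  imports "HOL-Probability.Probability"
begin

definition is_prob_density :: "'a measure \<Rightarrow> ('a \<Rightarrow> real) \<Rightarrow> bool" where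
  "is_prob_density M g \<longleftrightarrow> g \<in> borel_measurable M \<and> (\<forall>y\<in>space M. 0 \<le> g y) \<and>
     (\<integral>\<^sup>+ y. ennreal (g y) \<partial>M) = 1"

definition prior :: "'t measure \<Rightarrow> ('t \<Rightarrow> real) \<Rightarrow> 't measure" where
  "prior \<nu> \<pi> = density \<nu> (\<lambda>\<theta>. ennreal (\<pi> \<theta>))"

text \<open>The likelihood is written \<open>f x \<theta>\<close>, with the observation first as in \<open>f(x | \<theta>)\<close>.\<close>

definition prior_predictive ::
    "'t measure \<Rightarrow> ('t \<Rightarrow> real) \<Rightarrow> ('x \<Rightarrow> 't \<Rightarrow> real) \<Rightarrow> 'x \<Rightarrow> ennreal" where
  "prior_predictive \<nu> \<pi> f x = (\<integral>\<^sup>+ \<theta>. ennreal (f x \<theta>) \<partial>(prior \<nu> \<pi>))"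

definition posterior_density ::
    "'t measure \<Rightarrow> ('t \<Rightarrow> real) \<Rightarrow> ('x \<Rightarrow> 't \<Rightarrow> real) \<Rightarrow> 'x \<Rightarrow> 't \<Rightarrow> ennreal" where
  "posterior_density \<nu> \<pi> f x \<theta> =
     ennreal (\<pi> \<theta>) * ennreal (f x \<theta>) / prior_predictive \<nu> \<pi> f x"

definition posterior ::
    "'t measure \<Rightarrow> ('t \<Rightarrow> real) \<Rightarrow> ('x \<Rightarrow> 't \<Rightarrow> real) \<Rightarrow> 'x \<Rightarrow> 't measure" where
  "posterior \<nu> \<pi> f x = density \<nu> (posterior_density \<nu> \<pi> f x)"

definition relative_belief_ratio :: "('p \<Rightarrow> real) \<Rightarrow> ('p \<Rightarrow> real) \<Rightarrow> 'p \<Rightarrow> real" where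
  "relative_belief_ratio prior_dens post_dens \<psi> = post_dens \<psi> / prior_dens \<psi>"

text \<open>
  Below, \<open>Q\<close> is the marginal posterior of the parameter of interest, so
  \<open>space Q\<close> is the set of its possible values. The cutoffs range over the extended reals:
  for \<open>\<gamma> = 0\<close> they are \<open>\<infinity>\<close> and \<open>-\<infinity>\<close>, and both regions are empty.
\<close>

definition rb_cutoff :: "'p measure \<Rightarrow> ('p \<Rightarrow> real) \<Rightarrow> real \<Rightarrow> ereal" where
  "rb_cutoff Q RB \<gamma> =
     Sup {c :: ereal. \<gamma> \<le> measure Q {\<psi> \<in> space Q. c \<le> ereal (RB \<psi>)}}"

definition rb_region :: "'p measure \<Rightarrow> ('p \<Rightarrow> real) \<Rightarrow> real \<Rightarrow> 'p set" where
  "rb_region Q RB \<gamma> = {\<psi> \<in> space Q. rb_cutoff Q RB \<gamma> \<le> ereal (RB \<psi>)}"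

definition posterior_risk :: "'p measure \<Rightarrow> ('p \<Rightarrow> 'p \<Rightarrow> real) \<Rightarrow> 'p \<Rightarrow> real" where
  "posterior_risk Q L \<psi> = (\<integral>\<zeta>. L \<zeta> \<psi> \<partial>Q)"

definition lpl_cutoff :: "'p measure \<Rightarrow> ('p \<Rightarrow> 'p \<Rightarrow> real) \<Rightarrow> real \<Rightarrow> ereal" where
  "lpl_cutoff Q L \<gamma> =
     Inf {k :: ereal. \<gamma> \<le> measure Q {\<psi> \<in> space Q. ereal (posterior_risk Q L \<psi>) \<le> k}}"

definition lpl_region :: "'p measure \<Rightarrow> ('p \<Rightarrow> 'p \<Rightarrow> real) \<Rightarrow> real \<Rightarrow> 'p set" where
  "lpl_region Q L \<gamma> = {\<psi> \<in> space Q. ereal (posterior_risk Q L \<psi>) \<le> lpl_cutoff Q L \<gamma>}"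

definition rb_loss :: "('t \<Rightarrow> 'p) \<Rightarrow> ('p \<Rightarrow> real) \<Rightarrow> 't \<Rightarrow> 'p \<Rightarrow> real" where
  "rb_loss \<Psi> prior_dens \<theta> \<psi> = indicator (- {\<psi>}) (\<Psi> \<theta>) / prior_dens (\<Psi> \<theta>)"

end

theory Submission
  imports Defs
begin

text \<open>
  Write \<open>Q\<close> for the marginal posterior and \<open>T\<close> for the sum of the relative belief
  ratios over the finitely many values of the parameter of interest. Under the loss
  \<open>L\<^sub>R\<^sub>B\<close> a value \<open>\<zeta> \<noteq> \<psi>\<close> contributes its posterior
  probability divided by its prior probability, that is, its relative belief ratio, to the
  posterior risk of \<open>\<psi>\<close>, while \<open>\<zeta> = \<psi>\<close> contributes nothing. So the
  posterior risk is \<open>T - RB(\<psi>)\<close> (lemma \<open>posterior_risk_rb_loss\<close>).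

  Both regions are built from the same family of sets, because
  \<open>RB(\<psi>) \<ge> c\<close> if and only if \<open>T - RB(\<psi>) \<le> T - c\<close>. The reflection
  \<open>c \<mapsto> T - c\<close> of the extended real line reverses the order, so it turns the supremum
  that defines the relative belief cutoff into the infimum that defines the posterior loss
  cutoff (lemma \<open>Inf_ereal_diff_vimage\<close>). The two cutoffs therefore cut out the same set
  of values (lemma \<open>lpl_region_eq_rb_region\<close>).
\<close>

text \<open>
  Since \<open>T\<close> is finite, \<open>c \<mapsto> T - c\<close> is an order-reversing involution even at the
  infinite points.
\<close>

lemma le_ereal_diff_swap: "a \<le> ereal T - b \<longleftrightarrow> b \<le> ereal T - a"
  by (cases a; cases b) auto

text \<open>
  The set on the left is the image of \<open>A\<close> under the reflection. The identity also holds
  for empty \<open>A\<close>, where both sides are \<open>\<infinity>\<close>.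
\<close>

lemma Inf_ereal_diff_vimage: "Inf {k. ereal T - k \<in> A} = ereal T - Sup A"
proof (rule antisym)
  have "Inf {k. ereal T - k \<in> A} \<le> ereal T - a" if "a \<in> A" for a
  proof (rule Inf_lower)
    have "ereal T - (ereal T - a) = a" by (cases a) auto
    then show "ereal T - a \<in> {k. ereal T - k \<in> A}" using that by simp
  qed
  then have "Sup A \<le> ereal T - Inf {k. ereal T - k \<in> A}"
    by (intro Sup_least) (simp add: le_ereal_diff_swap)
  then show "Inf {k. ereal T - k \<in> A} \<le> ereal T - Sup A"
    by (simp add: le_ereal_diff_swap)
next
  show "ereal T - Sup A \<le> Inf {k. ereal T - k \<in> A}"
  proof (rule Inf_greatest)
    fix k assume "k \<in> {k. ereal T - k \<in> A}"
    then have "ereal T - k \<le> Sup A" by (simp add: Sup_upper)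
    then show "ereal T - Sup A \<le> k" by (cases k; cases "Sup A") auto
  qed
qed

text \<open>
  The sublevel set of the risk at \<open>k\<close> is the superlevel set of \<open>RB\<close> at \<open>T - k\<close>, so the
  levels admissible for one cutoff are the reflections of those admissible for the other.
\<close>

lemma lpl_region_eq_rb_region:
  assumes risk: "\<And>\<psi>. \<psi> \<in> space Q \<Longrightarrow> posterior_risk Q L \<psi> = T - RB \<psi>"
  shows "lpl_region Q L \<gamma> = rb_region Q RB \<gamma>"
proof -
  have swap: "ereal (posterior_risk Q L \<psi>) \<le> k \<longleftrightarrow> ereal T - k \<le> ereal (RB \<psi>)"
    if "\<psi> \<in> space Q" for \<psi> k
    using risk[OF that] by (cases k) auto
  let ?A = "{c :: ereal. \<gamma> \<le> measure Q {\<psi> \<in> space Q. c \<le> ereal (RB \<psi>)}}"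
  have "{\<psi> \<in> space Q. ereal (posterior_risk Q L \<psi>) \<le> k}
      = {\<psi> \<in> space Q. ereal T - k \<le> ereal (RB \<psi>)}" for k
    using swap by blast
  then have "lpl_cutoff Q L \<gamma> = Inf {k. ereal T - k \<in> ?A}"
    by (simp add: lpl_cutoff_def)
  also have "\<dots> = ereal T - rb_cutoff Q RB \<gamma>"
    by (simp only: Inf_ereal_diff_vimage rb_cutoff_def)
  finally have cutoff: "lpl_cutoff Q L \<gamma> = ereal T - rb_cutoff Q RB \<gamma>" .
  have "ereal T - (ereal T - rb_cutoff Q RB \<gamma>) = rb_cutoff Q RB \<gamma>"
    by (cases "rb_cutoff Q RB \<gamma>") auto
  with swap show ?thesis
    by (auto simp: lpl_region_def rb_region_def cutoff)
qed

text \<open>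
  The weight \<open>1 / prior_dens \<zeta>\<close> of the loss turns each posterior probability into a
  relative belief ratio, and the indicator removes the ratio of the decision \<open>\<psi>\<close> itself.
\<close>

lemma posterior_risk_rb_loss:
  assumes fin: "finite S"
    and nonneg: "\<And>\<zeta>. \<zeta> \<in> S \<Longrightarrow> 0 \<le> post_dens \<zeta>"
    and loss: "\<And>\<zeta>. \<zeta> \<in> S \<Longrightarrow> L \<zeta> \<psi> = indicator (- {\<psi>}) \<zeta> / prior_dens \<zeta>"
    and \<psi>: "\<psi> \<in> S"
  shows "posterior_risk (density (count_space S) (\<lambda>\<zeta>. ennreal (post_dens \<zeta>))) L \<psi>
       = (\<Sum>\<zeta>\<in>S. relative_belief_ratio prior_dens post_dens \<zeta>)
         - relative_belief_ratio prior_dens post_dens \<psi>"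
proof -
  have "posterior_risk (density (count_space S) (\<lambda>\<zeta>. ennreal (post_dens \<zeta>))) L \<psi>
      = (\<integral>\<zeta>. post_dens \<zeta> *\<^sub>R L \<zeta> \<psi> \<partial>count_space S)"
    unfolding posterior_risk_def
    by (rule integral_density) (auto simp: AE_count_space nonneg)
  also have "\<dots> = (\<Sum>\<zeta>\<in>S. post_dens \<zeta> * L \<zeta> \<psi>)"
    using fin by (simp add: lebesgue_integral_count_space_finite)
  also have "\<dots> = (\<Sum>\<zeta>\<in>S - {\<psi>}. post_dens \<zeta> * L \<zeta> \<psi>)"
    using fin \<psi> by (simp add: sum.remove[of S \<psi>] loss)
  also have "\<dots> = (\<Sum>\<zeta>\<in>S - {\<psi>}. relative_belief_ratio prior_dens post_dens \<zeta>)"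
    by (rule sum.cong) (auto simp: loss relative_belief_ratio_def)
  also have "\<dots> = (\<Sum>\<zeta>\<in>S. relative_belief_ratio prior_dens post_dens \<zeta>)
      - relative_belief_ratio prior_dens post_dens \<psi>"
    using fin \<psi> by (simp add: sum_diff1)
  finally show ?thesis .
qed

theorem theorem8:
  fixes \<mu> :: "'x measure" and \<nu> :: "'t measure" and \<nu>\<^sub>\<Psi> :: "'p measure"
    and f :: "'x \<Rightarrow> 't \<Rightarrow> real" and \<pi> :: "'t \<Rightarrow> real" and \<Psi> :: "'t \<Rightarrow> 'p"
    and x :: 'x and prior_dens post_dens :: "'p \<Rightarrow> real"
    and L :: "'p \<Rightarrow> 'p \<Rightarrow> real" and \<gamma> :: real
  assumes sampling_density: "\<And>\<theta>. \<theta> \<in> space \<nu> \<Longrightarrow> is_prob_density \<mu> (\<lambda>y. f y \<theta>)"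
    and likelihood_measurable: "\<And>y. y \<in> space \<mu> \<Longrightarrow> f y \<in> borel_measurable \<nu>"
    and proper_prior: "is_prob_density \<nu> \<pi>"
    and x: "x \<in> space \<mu>"
    and predictive: "0 < prior_predictive \<nu> \<pi> f x" "prior_predictive \<nu> \<pi> f x < \<infinity>"
    and finite_range: "finite (\<Psi> ` space \<nu>)"
    and counting: "\<nu>\<^sub>\<Psi> = count_space (\<Psi> ` space \<nu>)"
    and Psi_measurable: "\<Psi> \<in> measurable \<nu> \<nu>\<^sub>\<Psi>"
    and prior_dens: "distributed (prior \<nu> \<pi>) \<nu>\<^sub>\<Psi> \<Psi> (\<lambda>\<psi>. ennreal (prior_dens \<psi>))"
    and prior_dens_pos: "\<And>\<psi>. \<psi> \<in> \<Psi> ` space \<nu> \<Longrightarrow> 0 < prior_dens \<psi>"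
    and post_dens: "distributed (posterior \<nu> \<pi> f x) \<nu>\<^sub>\<Psi> \<Psi> (\<lambda>\<psi>. ennreal (post_dens \<psi>))"
    and post_dens_nonneg: "\<And>\<psi>. \<psi> \<in> \<Psi> ` space \<nu> \<Longrightarrow> 0 \<le> post_dens \<psi>"
    and loss: "\<And>\<theta> \<psi>. \<theta> \<in> space \<nu> \<Longrightarrow> \<psi> \<in> \<Psi> ` space \<nu> \<Longrightarrow>
                 rb_loss \<Psi> prior_dens \<theta> \<psi> = L (\<Psi> \<theta>) \<psi>"
    and gamma: "0 \<le> \<gamma>" "\<gamma> \<le> 1"
  shows "rb_region (distr (posterior \<nu> \<pi> f x) \<nu>\<^sub>\<Psi> \<Psi>)
             (relative_belief_ratio prior_dens post_dens) \<gamma>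
       = lpl_region (distr (posterior \<nu> \<pi> f x) \<nu>\<^sub>\<Psi> \<Psi>) L \<gamma>"
proof -
  let ?S = "\<Psi> ` space \<nu>"
  let ?RB = "relative_belief_ratio prior_dens post_dens"
  let ?Q = "distr (posterior \<nu> \<pi> f x) \<nu>\<^sub>\<Psi> \<Psi>"
  have Q: "?Q = density (count_space ?S) (\<lambda>\<psi>. ennreal (post_dens \<psi>))"
    using distributed_distr_eq_density[OF post_dens] by (simp add: counting)
  have L: "L \<zeta> \<psi> = indicator (- {\<psi>}) \<zeta> / prior_dens \<zeta>" if "\<zeta> \<in> ?S" "\<psi> \<in> ?S" for \<zeta> \<psi>
    using that loss unfolding rb_loss_def by force
  have "posterior_risk ?Q L \<psi> = (\<Sum>\<zeta>\<in>?S. ?RB \<zeta>) - ?RB \<psi>" if "\<psi> \<in> space ?Q" for \<psi>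
  proof -
    from that have "\<psi> \<in> ?S" by (simp add: counting)
    then show ?thesis
      unfolding Q using finite_range post_dens_nonneg L
      by (intro posterior_risk_rb_loss) auto
  qed
  from lpl_region_eq_rb_region[OF this] show ?thesis by (rule sym)
qed

end
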